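(* Let $C_0\subseteq\mathbb{R}^d$ be a proper compact convex set, and let $C=C_0\setminus\bigcup_{i=1}^\infty G_i$, where $\{G_i\}_i$ are open convex gaps. Then $$\dim_H(C)\ \ge\ d-1+\frac{\log 2}{\log\big(2+1/\tau(C)\big)},$$ where $\tau(C)$ is the thickness of $C$.
   Context: $\dim_H$ denotes Hausdorff dimension and $\operatorname{dist}$ Euclidean distance. "Proper" compact convex set means one with non-empty interior. That the $G_i$ are the gaps of $C$ means that they are the (finitely or countably many, pairwise disjoint) bounded components of $\mathbb{R}^d\setminus C$, contained in $C_0$; here each is assumed open and convex. Conventions: $1/(+\infty)=0$, and for $\tau(C)=0$ the fraction $\frac{\log 2}{\log(2+1/\tau(C))}$ is read as $0$. Thickness in $\mathbb{R}^d$. For a compact set $C\subset\mathbb{R}^d$, let $(G_n)_n$ be the (at most countably many, possibly finitely many) bounded open path-connected components of $\mathbb{R}^d\setminus C$, ordered by non-increasing diameter (the order among equal diameters is irrelevant), and let $E$ be the unbounded open path-connected component of $\mathbb{R}^d\setminus C$ (when $d=1$, $E$ is the union of the two unbounded intervals). If $E$ is not the only component of $\mathbb{R}^d\setminus C$, the thickness of $C$ is $$\tau(C):=\inf_n\frac{\operatorname{dist}\big(G_n,\ \bigcup_{1\le i\le n-1}G_i\cup E\big)}{\operatorname{diam}(G_n)},$$ the infimum being over the index set of the $G_n$. If $E$ is the only component, $\tau(C):=+\infty$ when $C$ has non-empty interior and $\tau(C):=0$ when $C$ has empty interior. *)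

theory Defs
  imports "HOL-Analysis.Analysis"
begin

text \<open>
  The term of a cover contributed by a bounded set \<open>U\<close>, that is, its diameter to the power \<open>s\<close>.
  For \<open>s = 0\<close> every non-empty set contributes 1; this case is separate because
  \<open>0 powr 0 = 0\<close>.
\<close>
definition diam_powr :: "real \<Rightarrow> 'a::metric_space set \<Rightarrow> ennreal" where
  "diam_powr s U =
     (if U = {} then 0 else if s = 0 then 1 else ennreal (diameter U powr s))"

text \<open>
  Finite covers are included, since the sets \<open>U i\<close> may be empty. Boundedness is required
  explicitly because \<^const>\<open>diameter\<close> is meaningless on unbounded sets.
\<close>
definition hausdorff_premeasure :: "real \<Rightarrow> real \<Rightarrow> 'a::metric_space set \<Rightarrow> ennreal" where
  "hausdorff_premeasure s \<delta> S =
     (INF U \<in> {U :: nat \<Rightarrow> 'a set. S \<subseteq> (\<Union>i. U i) \<and> (\<forall>i. bounded (U i) \<and> diameter (U i) \<le> \<delta>)}.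
        \<Sum>i. diam_powr s (U i))"

definition hausdorff_measure :: "real \<Rightarrow> 'a::metric_space set \<Rightarrow> ennreal" where
  "hausdorff_measure s S = (SUP \<delta>\<in>{0<..}. hausdorff_premeasure s \<delta> S)"

definition hausdorff_dim :: "'a::metric_space set \<Rightarrow> ereal" where
  "hausdorff_dim S = (INF s\<in>{s. 0 \<le> s \<and> hausdorff_measure s S = 0}. ereal s)"

definition path_components :: "'a::topological_space set \<Rightarrow> 'a set set" where
  "path_components S = path_component_set S ` S"

definition gaps :: "'a::euclidean_space set \<Rightarrow> 'a set set" where
  "gaps C = {U \<in> path_components (- C). bounded U}"

text \<open>
  For compact \<open>C\<close> there is exactly one unbounded component in dimension at least 2; in
  dimension 1 there are two, and the exterior is their union.
\<close>
definition exterior :: "'a::euclidean_space set \<Rightarrow> 'a set" where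
  "exterior C = \<Union>{U \<in> path_components (- C). \<not> bounded U}"

text \<open>
  An arrangement of the gaps by non-increasing diameter: \<open>r H G\<close> says that \<open>H\<close> is listed
  before \<open>G\<close>. A strict linear order is used instead of an enumeration by natural numbers because
  the latter need not exist in dimension at least 2, where infinitely many
  gaps can have diameter above a fixed positive bound. When an enumeration exists, the
  thickness is the usual infimum along it, see \<open>thickness_sequence\<close> below.
\<close>
definition gap_ordering :: "'a::euclidean_space set \<Rightarrow> ('a set \<Rightarrow> 'a set \<Rightarrow> bool) \<Rightarrow> bool" where
  "gap_ordering C r \<longleftrightarrow>
     irreflp_on (gaps C) r \<and> transp_on (gaps C) r \<and> totalp_on (gaps C) r \<and>
     (\<forall>H\<in>gaps C. \<forall>G\<in>gaps C. r H G \<longrightarrow> diameter G \<le> diameter H)"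

definition ordered_thickness ::
    "'a::euclidean_space set \<Rightarrow> ('a set \<Rightarrow> 'a set \<Rightarrow> bool) \<Rightarrow> ereal" where
  "ordered_thickness C r =
     (INF G\<in>gaps C. ereal (setdist G (\<Union>{H \<in> gaps C. r H G} \<union> exterior C) / diameter G))"

text \<open>
  The choice of the ordering does not matter, see \<open>thickness_eq_ordered\<close> below.
\<close>
definition thickness :: "'a::euclidean_space set \<Rightarrow> ereal" where
  "thickness C =
     (if gaps C \<noteq> {} then ordered_thickness C (SOME r. gap_ordering C r)
      else if interior C \<noteq> {} then \<infinity> else 0)"

lemma gaps_eq_components:
  fixes C :: "'a::euclidean_space set"
  assumes "compact C"
  shows "gaps C = {U \<in> components (- C). bounded U}"
proof -
  have "open (- C)"
    using assms compact_imp_closed by blast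
  then have "path_component_set (- C) x = connected_component_set (- C) x" for x
    by (rule open_path_connected_component_set)
  then show ?thesis
    unfolding gaps_def path_components_def components_def by auto
qed

lemma gap_ordering_exists: "\<exists>r. gap_ordering C r"
proof -
  obtain w :: "'a set rel" where w: "Well_order w" "Field w = UNIV"
    using well_ordering[where 'a = "'a set"] by blast
  then have w_props: "trans w" "antisym w" "total w"
    unfolding well_order_on_def linear_order_on_def partial_order_on_def preorder_on_def
    by auto
  define r where "r = (\<lambda>H G :: 'a set. diameter G < diameter H \<or>
                        diameter G = diameter H \<and> H \<noteq> G \<and> (H, G) \<in> w)"
  have "gap_ordering C r"
    unfolding gap_ordering_def
  proof (intro conjI)
    show "irreflp_on (gaps C) r"
      by (auto simp: irreflp_on_def r_def)
    show "transp_on (gaps C) r"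
      using w_props unfolding transp_on_def r_def
      by (smt (verit) antisymD transD)
    show "totalp_on (gaps C) r"
      using w_props(3) unfolding totalp_on_def r_def total_on_def
      by (metis UNIV_I linorder_less_linear)
    show "\<forall>H\<in>gaps C. \<forall>G\<in>gaps C. r H G \<longrightarrow> diameter G \<le> diameter H"
      by (auto simp: r_def)
  qed
  then show ?thesis by blast
qed

lemma ordered_thickness_le:
  fixes C :: "'a::euclidean_space set"
  assumes r: "gap_ordering C r" and r': "gap_ordering C r'"
    and ext: "exterior C \<noteq> {}"
  shows "ordered_thickness C r \<le> ordered_thickness C r'"
  unfolding ordered_thickness_def[of C r']
proof (rule INF_greatest)
  let ?P = "\<lambda>r G. \<Union>{H \<in> gaps C. r H G} \<union> exterior C"
  fix G assume G: "G \<in> gaps C"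
  have ne: "H \<noteq> {}" if "H \<in> gaps C" for H
    using that path_component_refl_eq by (fastforce simp: gaps_def path_components_def)
  have low: "ordered_thickness C r \<le> ereal (dist x y / diameter H)"
    if "H \<in> gaps C" "x \<in> H" "y \<in> ?P r H" for H x y
  proof -
    have "ordered_thickness C r \<le> ereal (setdist H (?P r H) / diameter H)"
      unfolding ordered_thickness_def by (rule INF_lower) fact
    also have "\<dots> \<le> ereal (dist x y / diameter H)"
      using that setdist_le_dist[of x H y "?P r H"] diameter_ge_0[of H]
      by (auto simp: gaps_def intro!: divide_right_mono)
    finally show ?thesis .
  qed
  have bound: "ordered_thickness C r \<le> ereal (dist x y / diameter G)"
    if x: "x \<in> G" and y: "y \<in> ?P r' G" for x y
  proof (cases "y \<in> ?P r G")
    case True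
    then show ?thesis using low G x by blast
  next
    case False
    then obtain H where H: "H \<in> gaps C" "r' H G" "y \<in> H" "\<not> r H G"
      using y by blast
    moreover have "H \<noteq> G"
      using H(2) G r' by (auto simp: gap_ordering_def irreflp_on_def)
    ultimately have "r G H"
      using r G by (auto simp: gap_ordering_def totalp_on_def)
    then have "diameter H = diameter G"
      using H G r r' by (auto simp: gap_ordering_def intro: order.antisym)
    moreover have "x \<in> ?P r H"
      using x G \<open>r G H\<close> by blast
    ultimately show ?thesis
      using low[OF H(1) H(3)] by (simp add: dist_commute)
  qed
  show "ordered_thickness C r \<le> ereal (setdist G (?P r' G) / diameter G)"
  proof (cases "diameter G = 0")
    case True
    obtain x y where "x \<in> G" "y \<in> ?P r' G"
      using ne[OF G] ext by blast
    then show ?thesis using bound[of x y] True by simp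
  next
    case False
    then have pos: "diameter G > 0"
      using G diameter_ge_0[of G] by (auto simp: gaps_def)
    show ?thesis
    proof (rule ccontr)
      assume "\<not> ?thesis"
      then obtain t where t: "ereal (setdist G (?P r' G) / diameter G) < ereal t"
        "ereal t < ordered_thickness C r"
        using ereal_dense2 by (meson linorder_not_le)
      have "t * diameter G \<le> setdist G (?P r' G)"
      proof (rule le_setdistI)
        show "G \<noteq> {}" "?P r' G \<noteq> {}"
          using ne[OF G] ext by auto
        fix x y assume "x \<in> G" "y \<in> ?P r' G"
        then have "ereal t < ereal (dist x y / diameter G)"
          using bound t(2) by (meson less_le_trans)
        then show "t * diameter G \<le> dist x y"
          using pos by (simp add: field_simps)
      qed
      then show False
        using t(1) pos by (simp add: field_simps)
    qed
  qed
qed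

lemma exterior_nonempty:
  fixes C :: "'a::euclidean_space set"
  assumes "compact C"
  shows "exterior C \<noteq> {}"
proof -
  have "open (- C)"
    using assms compact_imp_closed by blast
  moreover obtain x where "x \<in> - C" "\<not> bounded (connected_component_set (- C) x)"
    using cobounded_unbounded_component[of "- C"] assms compact_imp_bounded by auto
  ultimately have "x \<in> path_component_set (- C) x" "\<not> bounded (path_component_set (- C) x)"
    by (simp_all add: path_component_refl_eq open_path_connected_component_set)
  with \<open>x \<in> - C\<close> show ?thesis
    unfolding exterior_def path_components_def by blast
qed

lemma thickness_eq_ordered:
  fixes C :: "'a::euclidean_space set"
  assumes "compact C" "gaps C \<noteq> {}" "gap_ordering C r"
  shows "thickness C = ordered_thickness C r"
proof -
  have "gap_ordering C (SOME r. gap_ordering C r)"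
    using gap_ordering_exists by (rule someI_ex)
  then have "ordered_thickness C (SOME r. gap_ordering C r) = ordered_thickness C r"
    using assms by (intro order.antisym ordered_thickness_le exterior_nonempty)
  then show ?thesis
    using assms(2) by (simp add: thickness_def)
qed

lemma thickness_sequence:
  fixes C :: "'a::euclidean_space set" and I :: "nat set"
  assumes "compact C" "gaps C \<noteq> {}" and G: "bij_betw G I (gaps C)"
    and mono: "\<And>i j. i \<in> I \<Longrightarrow> j \<in> I \<Longrightarrow> i \<le> j \<Longrightarrow> diameter (G j) \<le> diameter (G i)"
  shows "thickness C =
    (INF n\<in>I. ereal (setdist (G n) ((\<Union>i\<in>{i\<in>I. i < n}. G i) \<union> exterior C) / diameter (G n)))"
proof -
  define f where "f = inv_into I G"
  define r where "r = (\<lambda>H K. f H < f K)"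
  have inj: "inj_on G I" and im: "G ` I = gaps C"
    using G by (auto simp: bij_betw_def)
  have fG: "f (G i) = i" if "i \<in> I" for i
    using inj that by (simp add: f_def)
  have "gap_ordering C r"
    unfolding gap_ordering_def im[symmetric]
    by (auto simp: irreflp_on_def transp_on_def totalp_on_def r_def fG mono)
  then have "thickness C = ordered_thickness C r"
    using assms thickness_eq_ordered by blast
  also have "\<dots> = (INF n\<in>I. ereal (setdist (G n) (\<Union>{H \<in> gaps C. r H (G n)} \<union> exterior C) / diameter (G n)))"
    unfolding ordered_thickness_def by (subst im[symmetric]) (simp add: image_image)
  also have "\<dots> = (INF n\<in>I. ereal (setdist (G n) ((\<Union>i\<in>{i\<in>I. i < n}. G i) \<union> exterior C) / diameter (G n)))"
  proof (rule INF_cong[OF refl])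
    fix n assume n: "n \<in> I"
    have "{H \<in> gaps C. r H (G n)} = G ` {i\<in>I. i < n}"
      using n by (auto simp: im[symmetric] r_def fG)
    then show "ereal (setdist (G n) (\<Union>{H \<in> gaps C. r H (G n)} \<union> exterior C) / diameter (G n)) =
      ereal (setdist (G n) ((\<Union>i\<in>{i\<in>I. i < n}. G i) \<union> exterior C) / diameter (G n))"
      by simp
  qed
  finally show ?thesis .
qed

end

theory Submission
  imports Defs
begin

text \<open>
  Let \<open>q = 1 / \<tau>\<close> and \<open>\<beta> = log 2 / log (2 + q)\<close>, so that \<open>(2 + q) powr \<beta> = 2\<close>, and let \<open>d\<close> be
  the dimension. The proof bounds a Hausdorff content of \<open>C\<close> from below: whenever finitely many
  cubes of side lengths \<open>2 \<rho>\<^sub>i\<close> cover \<open>C\<close>, the sum of the \<open>(2 \<rho>\<^sub>i) powr (d - 1 + \<beta>)\<close> is at least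
  \<open>l powr (d - 1 + \<beta>)\<close>, where \<open>l\<close> is the side length of a cube \<open>Q\<close> contained in \<open>C0\<close>. Since \<open>C\<close>
  is compact, this gives the bound on the dimension (\<open>hausdorff_dim_geI\<close>).

  The content bound follows by slicing \<open>C\<close> with the lines parallel to a fixed coordinate vector
  \<open>e\<close> that meet \<open>Q\<close>. On each such line the cubes cut out intervals of length \<open>2 \<rho>\<^sub>i\<close>, and these
  satisfy \<open>\<Sum> (2 \<rho>\<^sub>i) powr \<beta> \<ge> l powr \<beta>\<close>. Integrating this inequality over \<open>Q\<close>, where the points
  whose line meets the \<open>i\<close>-th cube have measure at most \<open>(2 \<rho>\<^sub>i) ^ (d - 1) * l\<close>, gives the claim
  (\<open>sum_powr_ge_of_slices\<close>).

  On a line, the convex gaps cut out open intervals, and these inherit the separation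
  of the gaps, the length of a slice being at most the diameter of its gap
  (\<open>line_slice_content\<close>). The bound then is Newhouse's estimate for Cantor sets of given
  thickness (\<open>thick_interval_content\<close>), which needs no more than the following: the gap of
  largest diameter that meets the line and is not covered splits the segment into two bridges,
  each at least \<open>1 / q\<close> times as long as the gap, no covering interval meets both of them, and the
  \<open>\<beta>\<close>-th powers of their lengths sum up to at least that of the whole segment
  (\<open>powr_bridge_le\<close>).

  Without gaps, \<open>q = 0\<close> and \<open>\<beta> = 1\<close>, and the same argument applies.
  If the thickness is zero, then \<open>\<beta> = 0\<close>, and it suffices that every line through \<open>Q\<close> meets \<open>C\<close>.
  It does so on the boundary of \<open>C0\<close> (\<open>line_slice_nonempty\<close>).
\<close>

section \<open>Powers of lengths\<close>

text \<open>
  A gap of length \<open>y\<close> between bridges of lengths \<open>x\<close> and \<open>z\<close>. By the choice of \<open>\<beta>\<close>, equality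
  holds if \<open>x = z\<close> and \<open>y = q * x\<close>. The general case reduces to this one because \<open>t \<mapsto> t powr \<beta>\<close>
  has non-increasing increments.
\<close>
lemma powr_bridge_le:
  fixes x y z q \<beta> :: real
  assumes \<beta>: "0 \<le> \<beta>" "\<beta> \<le> 1" "(2 + q) powr \<beta> = 2" and q: "0 \<le> q"
    and x: "0 < x" and z: "0 < z" and y: "0 \<le> y" "y \<le> q * x" "y \<le> q * z"
  shows "(x + y + z) powr \<beta> \<le> x powr \<beta> + z powr \<beta>"
proof -
  \<comment> \<open>the shorter of the two bridges is called \<open>u\<close>\<close>
  have main: "(u + y + v) powr \<beta> \<le> u powr \<beta> + v powr \<beta>"
    if uv: "0 < u" "u \<le> v" "y \<le> q * u" for u v :: real
  proof -
    define m where "m = (1 + q) * u"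
    have m: "0 \<le> m" using uv q by (simp add: m_def)
    have "u powr \<beta> - (u + m) powr \<beta> \<le> v powr \<beta> - (v + m) powr \<beta>"
    proof (rule DERIV_nonneg_imp_nondecreasing[OF uv(2)])
      fix t assume t: "u \<le> t" "t \<le> v"
      have t0: "0 < t" using uv t by simp
      show "\<exists>D. ((\<lambda>t. t powr \<beta> - (t + m) powr \<beta>) has_real_derivative D) (at t) \<and> 0 \<le> D"
      proof (intro exI conjI)
        show "((\<lambda>t. t powr \<beta> - (t + m) powr \<beta>) has_real_derivative
            \<beta> * t powr (\<beta> - 1) - \<beta> * (t + m) powr (\<beta> - 1)) (at t)"
          using t0 m by (auto intro!: derivative_eq_intros)
        have "(t + m) powr (\<beta> - 1) \<le> t powr (\<beta> - 1)"
          using t0 m \<beta> by (intro powr_mono2') auto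
        then show "0 \<le> \<beta> * t powr (\<beta> - 1) - \<beta> * (t + m) powr (\<beta> - 1)"
          using \<beta> by (simp add: mult_left_mono)
      qed
    qed
    moreover have "(u + m) powr \<beta> = 2 * u powr \<beta>"
    proof -
      have "u + m = (2 + q) * u" by (simp add: m_def algebra_simps)
      then show ?thesis using \<beta> q uv by (simp add: powr_mult)
    qed
    moreover have "(u + y + v) powr \<beta> \<le> (v + m) powr \<beta>"
      using uv y \<beta> by (intro powr_mono2) (auto simp: m_def algebra_simps)
    ultimately show ?thesis by simp
  qed
  show ?thesis
  proof (cases "x \<le> z")
    case True
    then show ?thesis using main x y by blast
  next
    case False
    then show ?thesis using main[of z x] z y by (simp add: algebra_simps)
  qed
qed

lemma powr_sum_le_sum_powr:
  fixes w :: "'b \<Rightarrow> real"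
  assumes "finite A" "\<And>i. i \<in> A \<Longrightarrow> 0 \<le> w i" "0 \<le> \<beta>" "\<beta> \<le> 1"
  shows "(\<Sum>i\<in>A. w i) powr \<beta> \<le> (\<Sum>i\<in>A. w i powr \<beta>)"
proof (cases "(\<Sum>i\<in>A. w i) = 0")
  case True
  then show ?thesis by (simp add: sum_nonneg)
next
  case False
  define W where "W = (\<Sum>i\<in>A. w i)"
  have W: "0 < W" using False assms sum_nonneg[of A w] by (simp add: W_def less_le)
  have "w i / W * W powr \<beta> \<le> w i powr \<beta>" if "i \<in> A" for i
  proof -
    have le: "0 \<le> w i / W" "w i / W \<le> 1"
      using assms that W member_le_sum[of i A w] by (auto simp: W_def)
    have "w i / W \<le> (w i / W) powr \<beta>"
      using powr_mono'[OF assms(4) le] le by (simp only: powr_one)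
    then have "w i / W * W powr \<beta> \<le> (w i / W) powr \<beta> * W powr \<beta>"
      by (intro mult_right_mono) auto
    also have "\<dots> = w i powr \<beta>"
      using le W by (subst powr_mult[symmetric]) auto
    finally show ?thesis .
  qed
  then have "(\<Sum>i\<in>A. w i / W * W powr \<beta>) \<le> (\<Sum>i\<in>A. w i powr \<beta>)"
    by (rule sum_mono)
  moreover have "(\<Sum>i\<in>A. w i / W * W powr \<beta>) = W powr \<beta>"
    using W by (simp add: sum_distrib_right[symmetric] sum_divide_distrib[symmetric] W_def)
  ultimately show ?thesis by (simp add: W_def)
qed

section \<open>Newhouse's estimate on an interval\<close>

lemma interval_length_le_cover:
  fixes u v :: "'b \<Rightarrow> real"
  assumes "finite N" "\<And>i. i \<in> N \<Longrightarrow> u i \<le> v i" "{a..b} \<subseteq> (\<Union>i\<in>N. {u i<..<v i})"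
  shows "b - a \<le> (\<Sum>i\<in>N. v i - u i)"
proof (cases "a \<le> b")
  case True
  have "measure lborel {a..b} \<le> measure lborel (\<Union>i\<in>N. {u i<..<v i})"
    using assms by (intro measure_mono_fmeasurable fmeasurable.finite_UN fmeasurableI) auto
  also have "\<dots> \<le> (\<Sum>i\<in>N. measure lborel {u i<..<v i})"
    using assms by (intro measure_UNION_le) auto
  also have "\<dots> = (\<Sum>i\<in>N. v i - u i)"
    using assms by (intro sum.cong) auto
  finally show ?thesis using True by simp
next
  case False
  moreover have "0 \<le> (\<Sum>i\<in>N. v i - u i)" using assms by (intro sum_nonneg) auto
  ultimately show ?thesis by simp
qed

text \<open>
  The intervals \<open>{u i<..<v i}\<close> cover \<open>{a..b}\<close> apart from the gaps \<open>{lo j<..<hi j}\<close>. The number \<open>D j\<close>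
  is an upper bound for the length of a gap (in the application, the diameter of the
  higher-dimensional gap of which it is a slice), and the distance required between two gaps is
  in terms of \<open>D\<close>, not of the lengths. The last assumption, that no gap is covered, ensures
  that no covering interval meets both sides of a gap.
\<close>
lemma thick_interval_content:
  fixes u v :: "'b \<Rightarrow> real" and lo hi D :: "'c \<Rightarrow> real"
  assumes \<beta>: "0 \<le> \<beta>" "\<beta> \<le> 1" "(2 + q) powr \<beta> = 2" and q: "0 \<le> q"
    and N: "finite N" "\<And>i. i \<in> N \<Longrightarrow> u i < v i"
    and "finite F" "a \<le> b"
    and "\<And>j. j \<in> F \<Longrightarrow> lo j < hi j \<and> hi j - lo j \<le> D j"
    and "\<And>j. j \<in> F \<Longrightarrow> D j \<le> q * (lo j - a) \<and> D j \<le> q * (b - hi j)"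
    and "\<And>j k s t. j \<in> F \<Longrightarrow> k \<in> F \<Longrightarrow> j \<noteq> k \<Longrightarrow> s \<in> {lo j..hi j} \<Longrightarrow> t \<in> {lo k..hi k} \<Longrightarrow>
           min (D j) (D k) \<le> q * \<bar>s - t\<bar>"
    and "{a..b} \<subseteq> (\<Union>i\<in>N. {u i<..<v i}) \<union> (\<Union>j\<in>F. {lo j<..<hi j})"
    and "\<And>j. j \<in> F \<Longrightarrow> \<not> {lo j<..<hi j} \<subseteq> (\<Union>i\<in>N. {u i<..<v i})"
  shows "(b - a) powr \<beta> \<le> (\<Sum>i | i \<in> N \<and> {u i<..<v i} \<inter> {a..b} \<noteq> {}. (v i - u i) powr \<beta>)"
  using assms(7-)
proof (induction F arbitrary: a b rule: finite_psubset_induct)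
  case (psubset F)
  let ?N = "\<lambda>a b. {i \<in> N. {u i<..<v i} \<inter> {a..b} \<noteq> {}}"
  note len = psubset.prems(2) and ends = psubset.prems(3) and sep = psubset.prems(4)
    and cov = psubset.prems(5) and unc = psubset.prems(6)
  show ?case
  proof (cases "F = {}")
    case True
    have "b - a \<le> (\<Sum>i\<in>?N a b. v i - u i)"
    proof (rule interval_length_le_cover)
      show "finite (?N a b)" using N(1) by simp
      show "u i \<le> v i" if "i \<in> ?N a b" for i using N(2)[of i] that by simp
      show "{a..b} \<subseteq> (\<Union>i\<in>?N a b. {u i<..<v i})" using cov True by fastforce
    qed
    then have "(b - a) powr \<beta> \<le> (\<Sum>i\<in>?N a b. v i - u i) powr \<beta>"
      using psubset.prems(1) \<beta> by (intro powr_mono2) auto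
    also have "\<dots> \<le> (\<Sum>i\<in>?N a b. (v i - u i) powr \<beta>)"
      using N \<beta> by (intro powr_sum_le_sum_powr) (auto intro: less_imp_le)
    finally show ?thesis .
  next
    case False
    \<comment> \<open>Split at the gap \<open>j\<close> with largest \<open>D\<close>: for all other gaps \<open>k\<close> the minimum of \<open>D j\<close> and \<open>D k\<close>
       is \<open>D k\<close>, so that the endpoints of \<open>j\<close> may play the role of \<open>a\<close> and \<open>b\<close>.\<close>
    have "Max (D ` F) \<in> D ` F" using False psubset.hyps by (intro Max_in) auto
    then obtain j where j: "j \<in> F" "D j = Max (D ` F)" by auto
    have jmax: "D k \<le> D j" if "k \<in> F" for k
      using that psubset.hyps by (simp add: j(2))
    define c d where "c = lo j" and "d = hi j"
    have cd: "c < d" "d - c \<le> D j" "D j \<le> q * (c - a)" "D j \<le> q * (b - d)"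
      using len[OF j(1)] ends[OF j(1)] by (auto simp: c_def d_def)
    have ac: "a < c" and db: "d < b"
      using cd q by (smt (verit, best) mult_nonneg_nonpos)+
    have side: "hi k \<le> c \<or> d \<le> lo k" if k: "k \<in> F" "k \<noteq> j" for k
    proof (rule ccontr)
      assume "\<not> ?thesis"
      then have "max c (lo k) \<in> {lo j..hi j}" "max c (lo k) \<in> {lo k..hi k}"
        using cd len[OF k(1)] by (auto simp: c_def d_def)
      from sep[OF j(1) k(1) _ this] k len[OF k(1)] len[OF j(1)] show False by auto
    qed
    define F1 F2 where "F1 = {k \<in> F. hi k \<le> c}" and "F2 = {k \<in> F. d \<le> lo k}"
    have F12: "k \<in> F1 \<or> k = j \<or> k \<in> F2" if "k \<in> F" for k
      using side that by (auto simp: F1_def F2_def)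
    have "F1 \<subseteq> F - {j}" "F2 \<subseteq> F - {j}"
      using cd by (auto simp: F1_def F2_def c_def d_def)
    then have sub: "F1 \<subset> F" "F2 \<subset> F"
      using j(1) by blast+
    have I1: "(c - a) powr \<beta> \<le> (\<Sum>i\<in>?N a c. (v i - u i) powr \<beta>)"
    proof (rule psubset.IH[OF sub(1)])
      fix k assume k: "k \<in> F1"
      then have kF: "k \<in> F" "hi k \<le> c" and kj: "k \<noteq> j"
        using cd by (auto simp: F1_def c_def d_def)
      have "min (D j) (D k) \<le> q * \<bar>c - hi k\<bar>"
        using kj by (intro sep[OF j(1) kF(1)]) (use cd len[OF kF(1)] in \<open>auto simp: c_def d_def\<close>)
      then show "D k \<le> q * (lo k - a) \<and> D k \<le> q * (c - hi k)"
        using ends[OF kF(1)] kF jmax[OF kF(1)] by (simp add: min_def split: if_splits)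
    next
      show "{a..c} \<subseteq> (\<Union>i\<in>N. {u i<..<v i}) \<union> (\<Union>j\<in>F1. {lo j<..<hi j})"
      proof
        fix t assume t: "t \<in> {a..c}"
        then have "t \<in> {a..b}" using cd db by auto
        then consider "t \<in> (\<Union>i\<in>N. {u i<..<v i})" | k where "k \<in> F" "t \<in> {lo k<..<hi k}"
          using cov by blast
        then show "t \<in> (\<Union>i\<in>N. {u i<..<v i}) \<union> (\<Union>j\<in>F1. {lo j<..<hi j})"
        proof cases
          case (2 k)
          then have "k \<in> F1" using F12[of k] t cd by (auto simp: F2_def c_def)
          then show ?thesis using 2 by blast
        qed auto
      qed
    next
      show "a \<le> c" using ac by simp
    next
      fix k assume "k \<in> F1"
      then have k: "k \<in> F" using sub by blast
      show "lo k < hi k \<and> hi k - lo k \<le> D k" by (rule len[OF k])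
      show "\<not> {lo k<..<hi k} \<subseteq> (\<Union>i\<in>N. {u i<..<v i})" by (rule unc[OF k])
    next
      fix k m s t
      assume "k \<in> F1" "m \<in> F1" "k \<noteq> m" "s \<in> {lo k..hi k}" "t \<in> {lo m..hi m}"
      then show "min (D k) (D m) \<le> q * \<bar>s - t\<bar>"
        using sub by (intro sep) blast+
    qed
    have I2: "(b - d) powr \<beta> \<le> (\<Sum>i\<in>?N d b. (v i - u i) powr \<beta>)"
    proof (rule psubset.IH[OF sub(2)])
      fix k assume k: "k \<in> F2"
      then have kF: "k \<in> F" "d \<le> lo k" and kj: "k \<noteq> j"
        using cd by (auto simp: F2_def c_def d_def)
      have "min (D j) (D k) \<le> q * \<bar>d - lo k\<bar>"
        using kj by (intro sep[OF j(1) kF(1)]) (use cd len[OF kF(1)] in \<open>auto simp: c_def d_def\<close>)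
      then show "D k \<le> q * (lo k - d) \<and> D k \<le> q * (b - hi k)"
        using ends[OF kF(1)] kF jmax[OF kF(1)] by (simp add: min_def split: if_splits)
    next
      show "{d..b} \<subseteq> (\<Union>i\<in>N. {u i<..<v i}) \<union> (\<Union>j\<in>F2. {lo j<..<hi j})"
      proof
        fix t assume t: "t \<in> {d..b}"
        then have "t \<in> {a..b}" using cd ac by auto
        then consider "t \<in> (\<Union>i\<in>N. {u i<..<v i})" | k where "k \<in> F" "t \<in> {lo k<..<hi k}"
          using cov by blast
        then show "t \<in> (\<Union>i\<in>N. {u i<..<v i}) \<union> (\<Union>j\<in>F2. {lo j<..<hi j})"
        proof cases
          case (2 k)
          then have "k \<in> F2" using F12[of k] t cd by (auto simp: F1_def d_def)
          then show ?thesis using 2 by blast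
        qed auto
      qed
    next
      show "d \<le> b" using db by simp
    next
      fix k assume "k \<in> F2"
      then have k: "k \<in> F" using sub by blast
      show "lo k < hi k \<and> hi k - lo k \<le> D k" by (rule len[OF k])
      show "\<not> {lo k<..<hi k} \<subseteq> (\<Union>i\<in>N. {u i<..<v i})" by (rule unc[OF k])
    next
      fix k m s t
      assume "k \<in> F2" "m \<in> F2" "k \<noteq> m" "s \<in> {lo k..hi k}" "t \<in> {lo m..hi m}"
      then show "min (D k) (D m) \<le> q * \<bar>s - t\<bar>"
        using sub by (intro sep) blast+
    qed
    obtain p where p: "p \<in> {c<..<d}" "p \<notin> (\<Union>i\<in>N. {u i<..<v i})"
      using unc[OF j(1)] unfolding c_def d_def by blast
    have "?N a c \<inter> ?N d b = {}"
    proof -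
      have False if i: "i \<in> ?N a c" "i \<in> ?N d b" for i
      proof -
        obtain s where "s \<in> {u i<..<v i}" "s \<in> {a..c}" using i(1) by blast
        moreover obtain t where "t \<in> {u i<..<v i}" "t \<in> {d..b}" using i(2) by blast
        ultimately have "p \<in> {u i<..<v i}" using p by auto
        then show False using p i by auto
      qed
      then show ?thesis by blast
    qed
    have "(b - a) powr \<beta> = ((c - a) + (d - c) + (b - d)) powr \<beta>" by simp
    also have "\<dots> \<le> (c - a) powr \<beta> + (b - d) powr \<beta>"
      using ac db cd by (intro powr_bridge_le[OF \<beta> q]) auto
    also have "\<dots> \<le> (\<Sum>i\<in>?N a c. (v i - u i) powr \<beta>) + (\<Sum>i\<in>?N d b. (v i - u i) powr \<beta>)"
      using I1 I2 by simp
    also have "\<dots> = (\<Sum>i\<in>?N a c \<union> ?N d b. (v i - u i) powr \<beta>)"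
      using N \<open>?N a c \<inter> ?N d b = {}\<close> by (intro sum.union_disjoint[symmetric]) auto
    also have "\<dots> \<le> (\<Sum>i\<in>?N a b. (v i - u i) powr \<beta>)"
    proof (rule sum_mono2)
      show "?N a c \<union> ?N d b \<subseteq> ?N a b" using cd ac db by fastforce
    qed (use N in auto)
    finally show ?thesis .
  qed
qed

section \<open>Integration over the slices\<close>

text \<open>
  The line through \<open>y\<close> in direction \<open>e\<close> meets the open cube with centre \<open>x i\<close> and side length
  \<open>2 * \<rho> i\<close> if and only if \<open>\<bar>(y - x i) \<bullet> b\<bar> < \<rho> i\<close> for all coordinate vectors \<open>b\<close> other than \<open>e\<close>.
\<close>
lemma sum_powr_ge_of_slices:
  fixes x :: "'b \<Rightarrow> 'a::euclidean_space"
  assumes e: "e \<in> Basis" and l: "0 < l" and N: "finite N" "\<And>i. i \<in> N \<Longrightarrow> 0 < \<rho> i"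
    and slices: "\<And>y. y \<in> cbox (z - (l/2) *\<^sub>R One) (z + (l/2) *\<^sub>R One) \<Longrightarrow>
      l powr \<beta> \<le> (\<Sum>i | i \<in> N \<and> (\<forall>b\<in>Basis - {e}. \<bar>(y - x i) \<bullet> b\<bar> < \<rho> i). (2 * \<rho> i) powr \<beta>)"
  shows "l powr (real DIM('a) - 1 + \<beta>) \<le> (\<Sum>i\<in>N. (2 * \<rho> i) powr (real DIM('a) - 1 + \<beta>))"
proof -
  let ?Q = "cbox (z - (l/2) *\<^sub>R One) (z + (l/2) *\<^sub>R One)"
  define L where "L = (\<lambda>i. \<Sum>b\<in>Basis. (if b = e then z \<bullet> e - l/2 else x i \<bullet> b - \<rho> i) *\<^sub>R b)"
  define R where "R = (\<lambda>i. \<Sum>b\<in>Basis. (if b = e then z \<bullet> e + l/2 else x i \<bullet> b + \<rho> i) *\<^sub>R b)"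
  \<comment> \<open>a box containing the points of \<open>?Q\<close> whose line meets the \<open>i\<close>-th cube\<close>
  let ?B = "\<lambda>i. cbox (L i) (R i)"
  have L: "L i \<bullet> b = (if b = e then z \<bullet> e - l/2 else x i \<bullet> b - \<rho> i)"
    and R: "R i \<bullet> b = (if b = e then z \<bullet> e + l/2 else x i \<bullet> b + \<rho> i)" if "b \<in> Basis" for b i
    using that by (simp_all add: L_def R_def)
  have Q: "measure lborel ?Q = l ^ DIM('a)"
    using l by (subst measure_lborel_cbox) (auto simp: algebra_simps)
  have B: "measure lborel (?B i) = (2 * \<rho> i) ^ (DIM('a) - 1) * l" if i: "i \<in> N" for i
  proof -
    have "measure lborel (?B i) = (\<Prod>b\<in>Basis. (R i - L i) \<bullet> b)"
      using N(2)[OF i] l by (intro measure_lborel_cbox) (auto simp: L R)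
    also have "\<dots> = (\<Prod>b\<in>Basis. if b = e then l else 2 * \<rho> i)"
      by (intro prod.cong) (auto simp: L R inner_diff_left)
    also have "\<dots> = l * (\<Prod>b\<in>Basis - {e}. if b = e then l else 2 * \<rho> i)"
      using e by (subst prod.remove[of _ e]) auto
    also have "(\<Prod>b\<in>Basis - {e}. if b = e then l else 2 * \<rho> i) = (\<Prod>b\<in>Basis - {e}. 2 * \<rho> i)"
      by (intro prod.cong) auto
    also have "\<dots> = (2 * \<rho> i) ^ (DIM('a) - 1)"
      using e by (simp add: card_Diff_singleton)
    finally show ?thesis by simp
  qed
  have pw: "l powr \<beta> * indicator ?Q y \<le> (\<Sum>i\<in>N. (2 * \<rho> i) powr \<beta> * indicator (?B i) y)" for y
  proof (cases "y \<in> ?Q")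
    case True
    let ?M = "{i \<in> N. \<forall>b\<in>Basis - {e}. \<bar>(y - x i) \<bullet> b\<bar> < \<rho> i}"
    have inB: "y \<in> ?B i" if "i \<in> ?M" for i
      unfolding mem_box
    proof
      fix b :: 'a assume b: "b \<in> Basis"
      show "L i \<bullet> b \<le> y \<bullet> b \<and> y \<bullet> b \<le> R i \<bullet> b"
      proof (cases "b = e")
        case True
        then show ?thesis using \<open>y \<in> ?Q\<close> b
          by (auto simp: L R mem_box inner_diff_left inner_add_left)
      next
        case False
        then have "\<bar>(y - x i) \<bullet> b\<bar> < \<rho> i" using that b by blast
        then show ?thesis using b False by (auto simp: L R inner_diff_left)
      qed
    qed
    have "l powr \<beta> \<le> (\<Sum>i\<in>?M. (2 * \<rho> i) powr \<beta>)" by (rule slices[OF True])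
    also have "\<dots> = (\<Sum>i\<in>?M. (2 * \<rho> i) powr \<beta> * indicator (?B i) y)"
      using inB by (intro sum.cong) auto
    also have "\<dots> \<le> (\<Sum>i\<in>N. (2 * \<rho> i) powr \<beta> * indicator (?B i) y)"
      using N by (intro sum_mono2) auto
    finally show ?thesis using True by simp
  qed (auto intro!: sum_nonneg)
  have int: "integrable lborel (\<lambda>y. w * indicator (cbox s t) y)" for w :: real and s t :: 'a
    by (intro integrable_mult_right integrable_real_indicator) (auto simp: emeasure_lborel_cbox_eq)
  have "(\<integral>y. l powr \<beta> * indicator ?Q y \<partial>lborel)
      \<le> (\<integral>y. (\<Sum>i\<in>N. (2 * \<rho> i) powr \<beta> * indicator (?B i) y) \<partial>lborel)"
    by (intro integral_mono pw Bochner_Integration.integrable_sum int)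
  also have "\<dots> = (\<Sum>i\<in>N. (2 * \<rho> i) powr \<beta> * measure lborel (?B i))"
    by (subst Bochner_Integration.integral_sum) (use int in \<open>simp_all del: integrable_mult_right_iff\<close>)
  also have "(\<integral>y. l powr \<beta> * indicator ?Q y \<partial>lborel) = l powr \<beta> * measure lborel ?Q"
    by simp
  finally have "l powr \<beta> * l ^ DIM('a) \<le> (\<Sum>i\<in>N. (2 * \<rho> i) powr \<beta> * ((2 * \<rho> i) ^ (DIM('a) - 1) * l))"
    using B Q by simp
  also have "\<dots> = (\<Sum>i\<in>N. (2 * \<rho> i) powr \<beta> * (2 * \<rho> i) ^ (DIM('a) - 1)) * l"
    by (simp add: sum_distrib_right mult.assoc)
  also have "l ^ DIM('a) = l ^ (DIM('a) - 1) * l"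
    using power_minus_mult[of "DIM('a)" l] by simp
  finally have le: "l powr \<beta> * l ^ (DIM('a) - 1) \<le> (\<Sum>i\<in>N. (2 * \<rho> i) powr \<beta> * (2 * \<rho> i) ^ (DIM('a) - 1))"
    using l by simp
  have pow: "w powr \<beta> * w ^ (DIM('a) - 1) = w powr (real DIM('a) - 1 + \<beta>)" if "0 < w" for w :: real
  proof -
    have "w ^ (DIM('a) - 1) = w powr (real DIM('a) - 1)"
      using that powr_realpow[of w "DIM('a) - 1"] by (simp add: of_nat_diff Suc_leI)
    then show ?thesis by (simp add: powr_add mult.commute)
  qed
  have "l powr (real DIM('a) - 1 + \<beta>)
      \<le> (\<Sum>i\<in>N. (2 * \<rho> i) powr \<beta> * (2 * \<rho> i) ^ (DIM('a) - 1))"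
    using le unfolding pow[OF l] .
  also have "\<dots> = (\<Sum>i\<in>N. (2 * \<rho> i) powr (real DIM('a) - 1 + \<beta>))"
    using N(2) by (intro sum.cong refl pow) simp
  finally show ?thesis .
qed

section \<open>Separation of the gaps\<close>

text \<open>
  The thickness in a form that does not mention the ordering of the gaps: of two gaps with
  different diameters, the one with smaller diameter comes later, and if the diameters are equal,
  the order is irrelevant.
\<close>
lemma gap_separation:
  fixes C :: "'a::euclidean_space set"
  assumes C: "compact C" and \<tau>: "thickness C \<noteq> 0" and ne: "gaps C \<noteq> {}"
    and q: "q = real_of_ereal (1 / thickness C)"
  shows "0 \<le> q"
    and "G \<in> gaps C \<Longrightarrow> x \<in> closure G \<Longrightarrow> z \<in> closure (exterior C) \<Longrightarrow> diameter G \<le> q * dist x z"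
    and "G \<in> gaps C \<Longrightarrow> H \<in> gaps C \<Longrightarrow> G \<noteq> H \<Longrightarrow> x \<in> closure G \<Longrightarrow> z \<in> closure H \<Longrightarrow>
      min (diameter G) (diameter H) \<le> q * dist x z"
proof -
  obtain r where r: "gap_ordering C r" using gap_ordering_exists by blast
  let ?P = "\<lambda>G. \<Union>{H \<in> gaps C. r H G} \<union> exterior C"
  have eq: "thickness C = ordered_thickness C r"
    using thickness_eq_ordered[OF C ne r] .
  have le: "thickness C \<le> ereal (setdist G (?P G) / diameter G)" if "G \<in> gaps C" for G
    unfolding eq ordered_thickness_def by (rule INF_lower[OF that])
  have diam0: "0 \<le> diameter G" if "G \<in> gaps C" for G
    using that by (auto simp: gaps_def intro: diameter_ge_0)
  have "0 \<le> thickness C"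
    unfolding eq ordered_thickness_def
    by (rule INF_greatest) (auto simp: setdist_pos_le diam0)
  moreover obtain G0 where "G0 \<in> gaps C" using ne by blast
  ultimately obtain T where T: "thickness C = ereal T" "0 < T"
    using le[of G0] \<tau> by (cases "thickness C") auto
  have qT: "q = 1 / T" using q T by (simp add: one_ereal_def)
  show q0: "0 \<le> q" using qT T by simp
  have sep: "diameter G \<le> q * dist x z"
    if G: "G \<in> gaps C" and x: "x \<in> closure G" and z: "z \<in> closure (?P G)" for G x z
  proof -
    have "T \<le> setdist G (?P G) / diameter G" using le[OF G] T by simp
    then have "T * diameter G \<le> setdist G (?P G)"
      using diam0[OF G] T by (cases "diameter G = 0") (auto simp: field_simps)
    also have "\<dots> \<le> dist x z"
      using setdist_le_dist[OF x z] unfolding setdist_closure_1 setdist_closure_2 .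
    finally show ?thesis unfolding qT using T(2) by (simp add: field_simps)
  qed
  show "diameter G \<le> q * dist x z"
    if "G \<in> gaps C" "x \<in> closure G" "z \<in> closure (exterior C)"
    using that sep[of G x z] closure_mono[of "exterior C" "?P G"] by auto
  show "min (diameter G) (diameter H) \<le> q * dist x z"
    if G: "G \<in> gaps C" and H: "H \<in> gaps C" and GH: "G \<noteq> H"
      and x: "x \<in> closure G" and z: "z \<in> closure H"
  proof -
    consider "r H G" | "r G H"
      using r G H GH by (auto simp: gap_ordering_def totalp_on_def)
    then show ?thesis
    proof cases
      case 1
      then have "H \<subseteq> ?P G" using H by blast
      then have "diameter G \<le> q * dist x z"
        using sep[OF G x] z closure_mono by blast
      then show ?thesis by simp
    next
      case 2
      then have "G \<subseteq> ?P H" using G by blast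
      then have "diameter H \<le> q * dist z x"
        using sep[OF H z] x closure_mono by blast
      then show ?thesis by (simp add: dist_commute)
    qed
  qed
qed

lemma Compl_convex_subset_exterior:
  fixes C0 C :: "'a::euclidean_space set"
  assumes "convex C0" "bounded C0" "closed C" "C \<subseteq> C0"
  shows "- C0 \<subseteq> exterior C"
proof
  fix x assume x: "x \<in> - C0"
  then have "x \<in> outside C0" using outside_convex[OF assms(1)] by simp
  then have "\<not> bounded (connected_component_set (- C0) x)" by (simp add: outside)
  then have "\<not> bounded (connected_component_set (- C) x)"
    using connected_component_mono[of "- C0" "- C" x] assms(4) bounded_subset by blast
  then have "\<not> bounded (path_component_set (- C) x)"
    using assms(3) open_path_connected_component_set[of "- C" x] by (simp add: open_Compl)
  moreover have "x \<in> path_component_set (- C) x"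
    using x assms(4) by (auto simp: path_component_refl_eq)
  ultimately show "x \<in> exterior C"
    using x assms(4) unfolding exterior_def path_components_def by blast
qed

section \<open>Slices by lines\<close>

lemma line_Int_compact_convex:
  fixes C0 :: "'a::euclidean_space set"
  assumes C0: "compact C0" "convex C0" and e: "norm e = 1" and y: "y \<in> C0"
  obtains a b where "a \<le> b" "\<And>t. y + t *\<^sub>R e \<in> C0 \<longleftrightarrow> a \<le> t \<and> t \<le> b"
    "y + a *\<^sub>R e \<in> closure (- C0)" "y + b *\<^sub>R e \<in> closure (- C0)"
proof -
  let ?g = "\<lambda>t. y + t *\<^sub>R e"
  have dist: "dist (?g s) (?g t) = \<bar>s - t\<bar>" for s t
    using e by (simp add: dist_norm flip: scaleR_left_diff_distrib)
  have "closed (?g -` C0)"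
    using C0 by (intro closed_vimage compact_imp_closed continuous_intros) auto
  moreover have "bounded (?g -` C0)"
  proof -
    obtain K where K: "\<And>x. x \<in> C0 \<Longrightarrow> dist y x \<le> K"
      using compact_imp_bounded[OF C0(1)] bounded_any_center by (metis (no_types))
    have "dist 0 t \<le> K" if "t \<in> ?g -` C0" for t
      using K[of "?g t"] dist[of 0 t] that by simp
    then show ?thesis unfolding bounded_def by blast
  qed
  moreover have "convex (?g -` C0)"
  proof (rule convexI)
    fix s t u v :: real assume st: "s \<in> ?g -` C0" "t \<in> ?g -` C0" and uv: "0 \<le> u" "0 \<le> v" "u + v = 1"
    have "u *\<^sub>R ?g s + v *\<^sub>R ?g t = (u + v) *\<^sub>R y + (u * s + v * t) *\<^sub>R e"
      by (simp add: algebra_simps)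
    moreover have "u *\<^sub>R ?g s + v *\<^sub>R ?g t \<in> C0"
      using st uv by (intro convexD[OF C0(2)]) auto
    ultimately show "u *\<^sub>R s + v *\<^sub>R t \<in> ?g -` C0" using uv by simp
  qed
  ultimately obtain a b where ab: "?g -` C0 = {a..b}"
    using connected_compact_interval_1[of "?g -` C0"] convex_connected
      compact_eq_bounded_closed by metis
  then have iff: "?g t \<in> C0 \<longleftrightarrow> a \<le> t \<and> t \<le> b" for t
    by (metis atLeastAtMost_iff vimage_eq)
  have "a \<le> b" using iff[of 0] y by simp
  moreover have "?g a \<in> closure (- C0)"
    unfolding closure_approachable
  proof (intro allI impI)
    fix r :: real assume r: "0 < r"
    then have "?g (a - r / 2) \<in> - C0" using iff[of "a - r / 2"] by simp
    moreover have "dist (?g (a - r / 2)) (?g a) < r" unfolding dist using r by simp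
    ultimately show "\<exists>x\<in>- C0. dist x (?g a) < r" by blast
  qed
  moreover have "?g b \<in> closure (- C0)"
    unfolding closure_approachable
  proof (intro allI impI)
    fix r :: real assume r: "0 < r"
    then have "?g (b + r / 2) \<in> - C0" using iff[of "b + r / 2"] by simp
    moreover have "dist (?g (b + r / 2)) (?g b) < r" unfolding dist using r by simp
    ultimately show "\<exists>x\<in>- C0. dist x (?g b) < r" by blast
  qed
  ultimately show ?thesis using that iff by blast
qed

lemma line_mem_cube_iff:
  fixes y :: "'a::euclidean_space"
  assumes e: "e \<in> Basis"
  shows "y + t *\<^sub>R e \<in> box (x - \<rho> *\<^sub>R One) (x + \<rho> *\<^sub>R One) \<longleftrightarrow>
    (\<forall>b\<in>Basis - {e}. \<bar>(y - x) \<bullet> b\<bar> < \<rho>) \<and> t \<in> {(x - y) \<bullet> e - \<rho><..<(x - y) \<bullet> e + \<rho>}"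
proof -
  have "y + t *\<^sub>R e \<in> box (x - \<rho> *\<^sub>R One) (x + \<rho> *\<^sub>R One) \<longleftrightarrow>
    (\<forall>b\<in>Basis. \<bar>(y + t *\<^sub>R e - x) \<bullet> b\<bar> < \<rho>)"
    unfolding mem_box by (intro ball_cong) (auto simp: inner_diff_left inner_add_left)
  also have "\<dots> \<longleftrightarrow> (\<forall>b\<in>Basis - {e}. \<bar>(y + t *\<^sub>R e - x) \<bullet> b\<bar> < \<rho>) \<and> \<bar>(y + t *\<^sub>R e - x) \<bullet> e\<bar> < \<rho>"
    using e by auto
  also have "(\<forall>b\<in>Basis - {e}. \<bar>(y + t *\<^sub>R e - x) \<bullet> b\<bar> < \<rho>) \<longleftrightarrow> (\<forall>b\<in>Basis - {e}. \<bar>(y - x) \<bullet> b\<bar> < \<rho>)"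
    using e by (intro ball_cong) (auto simp: inner_diff_left inner_add_left inner_Basis)
  also have "\<bar>(y + t *\<^sub>R e - x) \<bullet> e\<bar> < \<rho> \<longleftrightarrow> t \<in> {(x - y) \<bullet> e - \<rho><..<(x - y) \<bullet> e + \<rho>}"
    using e by (auto simp: inner_diff_left inner_add_left)
  finally show ?thesis .
qed

lemma open_convex_bounded_real:
  fixes S :: "real set"
  assumes "open S" "convex S" "bounded S" "S \<noteq> {}"
  obtains lo hi where "lo < hi" "S = {lo<..<hi}"
proof -
  obtain lo hi where "closure S = {lo..hi}"
    using connected_compact_interval_1[of "closure S"] assms
    by (metis compact_eq_bounded_closed closed_closure bounded_closure connected_imp_connected_closure convex_connected)
  then have "S = {lo<..<hi}"
    using convex_interior_closure[OF assms(2)] assms(1) interior_atLeastAtMost_real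
    by (metis interior_open)
  moreover from this have "lo < hi" using assms(4) by simp
  ultimately show ?thesis using that by blast
qed

text \<open>
  The segment of length \<open>l\<close> in \<open>C0\<close> serves only to bound from below the length of the whole
  intersection of the line with \<open>C0\<close>, to which the one-dimensional estimate is applied.
\<close>
lemma line_slice_content:
  fixes C0 C :: "'a::euclidean_space set" and x :: "'b \<Rightarrow> 'a"
  assumes \<beta>: "0 \<le> \<beta>" "\<beta> \<le> 1" "(2 + q) powr \<beta> = 2" and q: "0 \<le> q"
    and C0: "compact C0" "convex C0" and C: "C = C0 - \<Union>\<G>"
    and \<G>: "\<And>H. H \<in> \<G> \<Longrightarrow> open H \<and> convex H \<and> H \<subseteq> C0"
    and sep0: "\<And>H x z. H \<in> \<G> \<Longrightarrow> x \<in> closure H \<Longrightarrow> z \<in> closure (- C0) \<Longrightarrow>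
      diameter H \<le> q * dist x z"
    and sep: "\<And>H K x z. H \<in> \<G> \<Longrightarrow> K \<in> \<G> \<Longrightarrow> H \<noteq> K \<Longrightarrow> x \<in> closure H \<Longrightarrow> z \<in> closure K \<Longrightarrow>
      min (diameter H) (diameter K) \<le> q * dist x z"
    and N: "finite N" "\<And>i. i \<in> N \<Longrightarrow> 0 < \<rho> i"
    and cov: "C \<subseteq> (\<Union>i\<in>N. box (x i - \<rho> i *\<^sub>R One) (x i + \<rho> i *\<^sub>R One))"
    and e: "e \<in> Basis" and l: "0 \<le> l"
    and seg: "y + s *\<^sub>R e \<in> C0" "y + (s + l) *\<^sub>R e \<in> C0" and y: "y \<in> C0"
  shows "l powr \<beta> \<le> (\<Sum>i | i \<in> N \<and> (\<forall>b\<in>Basis - {e}. \<bar>(y - x i) \<bullet> b\<bar> < \<rho> i). (2 * \<rho> i) powr \<beta>)"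
proof -
  let ?g = "\<lambda>t. y + t *\<^sub>R e"
  have dist: "dist (?g s) (?g t) = \<bar>s - t\<bar>" for s t
    using e by (simp add: dist_norm flip: scaleR_left_diff_distrib)
  obtain a b where ab: "a \<le> b" "\<And>t. ?g t \<in> C0 \<longleftrightarrow> a \<le> t \<and> t \<le> b"
    "?g a \<in> closure (- C0)" "?g b \<in> closure (- C0)"
    using line_Int_compact_convex[OF C0 _ y, of e] e by (metis norm_Basis)
  define M where "M = {i \<in> N. \<forall>b\<in>Basis - {e}. \<bar>(y - x i) \<bullet> b\<bar> < \<rho> i}"
  define u v where "u = (\<lambda>i. (x i - y) \<bullet> e - \<rho> i)" and "v = (\<lambda>i. (x i - y) \<bullet> e + \<rho> i)"
  have M: "finite M" "\<And>i. i \<in> M \<Longrightarrow> u i < v i"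
    using N by (auto simp: M_def u_def v_def)
  let ?U = "\<Union>i\<in>M. {u i<..<v i}"
  have covl: "t \<in> ?U \<or> (\<exists>H\<in>\<G>. ?g t \<in> H)" if t: "t \<in> {a..b}" for t
  proof (rule disjCI)
    assume "\<not> (\<exists>H\<in>\<G>. ?g t \<in> H)"
    then have "?g t \<in> C" using ab(2) t C by auto
    then obtain i where i: "i \<in> N" "?g t \<in> box (x i - \<rho> i *\<^sub>R One) (x i + \<rho> i *\<^sub>R One)"
      using cov by blast
    then have "i \<in> M" "t \<in> {u i<..<v i}"
      unfolding line_mem_cube_iff[OF e] M_def u_def v_def by auto
    then show "t \<in> ?U" by blast
  qed
  \<comment> \<open>By compactness, only finitely many gaps matter on this line.\<close>
  have "compact ({a..b} - ?U)" by (intro compact_diff open_UN) auto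
  moreover have slice_open: "open (?g -` H)" if "H \<in> \<G>" for H
    using \<G>[OF that] by (intro open_vimage continuous_intros) auto
  moreover have "{a..b} - ?U \<subseteq> (\<Union>H\<in>\<G>. ?g -` H)" using covl by blast
  ultimately obtain F0 where F0: "F0 \<subseteq> \<G>" "finite F0" "{a..b} - ?U \<subseteq> (\<Union>H\<in>F0. ?g -` H)"
    by (rule compactE_image)
  define F where "F = {H \<in> F0. \<not> ?g -` H \<subseteq> ?U}"
  have F: "finite F" "\<And>H. H \<in> F \<Longrightarrow> H \<in> \<G>" "\<And>H. H \<in> F \<Longrightarrow> \<not> ?g -` H \<subseteq> ?U"
    using F0 by (auto simp: F_def)
  have "\<exists>lo hi. lo < hi \<and> ?g -` H = {lo<..<hi}" if H: "H \<in> F" for H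
  proof -
    have "convex (?g -` H)"
    proof (rule convexI)
      fix s t c d :: real
      assume st: "s \<in> ?g -` H" "t \<in> ?g -` H" and cd: "0 \<le> c" "0 \<le> d" "c + d = 1"
      have "c *\<^sub>R ?g s + d *\<^sub>R ?g t = (c + d) *\<^sub>R y + (c * s + d * t) *\<^sub>R e"
        by (simp add: algebra_simps)
      moreover have "c *\<^sub>R ?g s + d *\<^sub>R ?g t \<in> H"
        using st cd \<G>[OF F(2)[OF H]] by (intro convexD[of H]) auto
      ultimately show "c *\<^sub>R s + d *\<^sub>R t \<in> ?g -` H" using cd by simp
    qed
    moreover have "bounded (?g -` H)"
      by (rule bounded_subset[OF bounded_closed_interval[of a b]])
        (use ab(2) \<G>[OF F(2)[OF H]] in auto)
    moreover have "?g -` H \<noteq> {}" using F(3)[OF H] by blast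
    ultimately show ?thesis
      using open_convex_bounded_real slice_open[OF F(2)[OF H]] by metis
  qed
  then obtain lo hi where lh: "\<And>H. H \<in> F \<Longrightarrow> lo H < hi H \<and> ?g -` H = {lo H<..<hi H}"
    by metis
  have clo: "?g t \<in> closure H" if H: "H \<in> F" and t: "t \<in> {lo H..hi H}" for H t
  proof -
    have "?g ` closure (?g -` H) \<subseteq> closure H"
      by (intro image_closure_subset continuous_intros) (auto simp: closure_subset[THEN subsetD])
    moreover have "t \<in> closure (?g -` H)" using lh[OF H] t by (simp add: closure_greaterThanLessThan)
    ultimately show ?thesis by blast
  qed
  have inab: "a \<le> lo H \<and> hi H \<le> b" if H: "H \<in> F" for H
  proof -
    have "{lo H<..<hi H} \<subseteq> {a..b}"
      using lh[OF H] \<G>[OF F(2)[OF H]] ab(2) by (metis atLeastAtMost_iff subsetD subsetI vimage_eq)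
    then have "closure {lo H<..<hi H} \<subseteq> {a..b}" by (intro closure_minimal) auto
    then show ?thesis using lh[OF H] by (simp add: closure_greaterThanLessThan)
  qed
  have "(b - a) powr \<beta> \<le> (\<Sum>i | i \<in> M \<and> {u i<..<v i} \<inter> {a..b} \<noteq> {}. (v i - u i) powr \<beta>)"
  proof (rule thick_interval_content[OF \<beta> q M F(1) ab(1), where lo = lo and hi = hi and D = diameter])
    fix H assume H: "H \<in> F"
    have bdd: "bounded H" using \<G>[OF F(2)[OF H]] C0 compact_imp_bounded bounded_subset by blast
    have "hi H - lo H = dist (?g (hi H)) (?g (lo H))" using lh[OF H] unfolding dist by simp
    also have "\<dots> \<le> diameter (closure H)"
      using bdd lh[OF H] by (intro diameter_bounded_bound clo[OF H]) auto
    finally show "lo H < hi H \<and> hi H - lo H \<le> diameter H"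
      using lh[OF H] bdd by (simp add: diameter_closure)
    show "diameter H \<le> q * (lo H - a) \<and> diameter H \<le> q * (b - hi H)"
      using sep0[OF F(2)[OF H] clo[OF H, of "lo H"] ab(3)]
        sep0[OF F(2)[OF H] clo[OF H, of "hi H"] ab(4)] lh[OF H] inab[OF H]
      unfolding dist by simp
    show "\<not> {lo H<..<hi H} \<subseteq> ?U" using F(3)[OF H] lh[OF H] by simp
  next
    fix H K s t assume HK: "H \<in> F" "K \<in> F" "H \<noteq> K" and st: "s \<in> {lo H..hi H}" "t \<in> {lo K..hi K}"
    show "min (diameter H) (diameter K) \<le> q * \<bar>s - t\<bar>"
      using sep[OF F(2)[OF HK(1)] F(2)[OF HK(2)] HK(3) clo[OF HK(1) st(1)] clo[OF HK(2) st(2)]]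
      unfolding dist .
  next
    show "{a..b} \<subseteq> ?U \<union> (\<Union>H\<in>F. {lo H<..<hi H})"
    proof
      fix t assume t: "t \<in> {a..b}"
      show "t \<in> ?U \<union> (\<Union>H\<in>F. {lo H<..<hi H})"
      proof (cases "t \<in> ?U")
        case False
        then obtain H where H: "H \<in> F0" "t \<in> ?g -` H" using F0(3) t by blast
        then have "H \<in> F" unfolding F_def using False by blast
        then show ?thesis using H lh by blast
      qed auto
    qed
  qed
  also have "\<dots> \<le> (\<Sum>i\<in>M. (v i - u i) powr \<beta>)"
    using M by (intro sum_mono2) auto
  also have "\<dots> = (\<Sum>i\<in>M. (2 * \<rho> i) powr \<beta>)" by (simp add: u_def v_def)
  finally have "(b - a) powr \<beta> \<le> (\<Sum>i\<in>M. (2 * \<rho> i) powr \<beta>)" .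
  moreover have "l \<le> b - a" using seg ab(2) by fastforce
  ultimately show ?thesis
    using powr_mono2[of \<beta> l "b - a"] l \<beta> unfolding M_def by linarith
qed

text \<open>
  Open gaps do not contain boundary points of \<open>C0\<close>, so the line meets \<open>C\<close> where it leaves \<open>C0\<close>.
\<close>
lemma line_slice_nonempty:
  fixes C0 C :: "'a::euclidean_space set" and x :: "'b \<Rightarrow> 'a"
  assumes C0: "compact C0" "convex C0" and C: "C = C0 - \<Union>\<G>"
    and \<G>: "\<And>H. H \<in> \<G> \<Longrightarrow> open H \<and> H \<subseteq> C0"
    and cov: "C \<subseteq> (\<Union>i\<in>N. box (x i - \<rho> i *\<^sub>R One) (x i + \<rho> i *\<^sub>R One))"
    and e: "e \<in> Basis" and y: "y \<in> C0"
  shows "\<exists>i\<in>N. \<forall>b\<in>Basis - {e}. \<bar>(y - x i) \<bullet> b\<bar> < \<rho> i"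
proof -
  obtain a b where ab: "a \<le> b" "\<And>t. y + t *\<^sub>R e \<in> C0 \<longleftrightarrow> a \<le> t \<and> t \<le> b"
    "y + a *\<^sub>R e \<in> closure (- C0)"
    using line_Int_compact_convex[OF C0 _ y, of e] e by (metis norm_Basis)
  have "y + a *\<^sub>R e \<notin> H" if "H \<in> \<G>" for H
    using \<G>[OF that] ab(3) by (auto simp: closure_complement dest: interior_maximal)
  then have "y + a *\<^sub>R e \<in> C" using C ab by auto
  then show ?thesis using cov line_mem_cube_iff[OF e] by blast
qed

section \<open>From content to Hausdorff dimension\<close>

text \<open>
  For a compact set, a lower bound for finite covers by open cubes suffices: the members of a
  countable cover by sets of diameter at most 1 are put into slightly larger open cubes, of which
  finitely many cover the set.
\<close>
lemma hausdorff_dim_geI: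
  fixes C :: "'a::euclidean_space set"
  assumes C: "compact C" and t: "0 \<le> t" and l: "0 < l"
    and content: "\<And>N x \<rho>. finite (N :: nat set) \<Longrightarrow> (\<And>i. i \<in> N \<Longrightarrow> 0 < \<rho> i) \<Longrightarrow>
      C \<subseteq> (\<Union>i\<in>N. box (x i - \<rho> i *\<^sub>R One) (x i + \<rho> i *\<^sub>R One)) \<Longrightarrow>
      l powr t \<le> (\<Sum>i\<in>N. (2 * \<rho> i) powr t)"
  shows "ereal t \<le> hausdorff_dim C"
  unfolding hausdorff_dim_def
proof (rule INF_greatest)
  fix s assume "s \<in> {s. 0 \<le> s \<and> hausdorff_measure s C = 0}"
  then have s: "0 \<le> s" "hausdorff_measure s C = 0" by auto
  show "ereal t \<le> ereal s"
  proof (rule ccontr)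
    assume "\<not> ?thesis"
    then have st: "s < t" and t0: "0 < t" using s by auto
    \<comment> \<open>\<open>\<kappa>\<close> bounds the sum over the given cover and \<open>\<eta>\<close> the loss in enlarging its members; the
       factor \<open>2 powr t\<close> arises because a set of diameter \<open>\<delta>\<close> is put into a cube of side length
       slightly more than \<open>2 * \<delta>\<close>.\<close>
    define \<kappa> where "\<kappa> = l powr t / (2 * 2 powr t)"
    define \<eta> where "\<eta> = l powr t / 4"
    have pos: "0 < \<kappa>" "0 < \<eta>" using l by (auto simp: \<kappa>_def \<eta>_def)
    have "hausdorff_premeasure s 1 C \<le> hausdorff_measure s C"
      unfolding hausdorff_measure_def by (rule SUP_upper) simp
    then have "hausdorff_premeasure s 1 C < ennreal \<kappa>"
      using s pos by simp
    then obtain U where U: "C \<subseteq> (\<Union>i. U i)" "\<And>i. bounded (U i)" "\<And>i. diameter (U i) \<le> 1"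
      and sum: "(\<Sum>i. diam_powr s (U i)) < ennreal \<kappa>"
      unfolding hausdorff_premeasure_def INF_less_iff by auto
    define d where "d = (\<lambda>i. diameter (U i))"
    have d: "0 \<le> d i" "d i \<le> 1" for i
      using U diameter_ge_0[of "U i"] by (auto simp: d_def)
    have "\<exists>\<rho>. d i < \<rho> \<and> (2 * \<rho>) powr t < (2 * d i) powr t + \<eta> * (1/2) ^ i" for i
    proof -
      have "((\<lambda>\<rho>. (2 * \<rho>) powr t) \<longlongrightarrow> (2 * d i) powr t) (at_right (d i))"
      proof (rule tendsto_powr')
        show "2 * d i \<noteq> 0 \<or> 0 < t \<and> (\<forall>\<^sub>F \<rho> in at_right (d i). 0 \<le> 2 * \<rho>)"
          using t0 d[of i] eventually_at_right_less[of "d i"]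
          by (auto elim!: eventually_mono)
      qed (auto intro!: tendsto_intros)
      moreover have "(2 * d i) powr t < (2 * d i) powr t + \<eta> * (1/2) ^ i" using pos by simp
      ultimately have "\<forall>\<^sub>F \<rho> in at_right (d i). (2 * \<rho>) powr t < (2 * d i) powr t + \<eta> * (1/2) ^ i"
        by (rule order_tendstoD)
      then have "\<forall>\<^sub>F \<rho> in at_right (d i). d i < \<rho> \<and> (2 * \<rho>) powr t < (2 * d i) powr t + \<eta> * (1/2) ^ i"
        using eventually_at_right_less[of "d i"] by eventually_elim auto
      then show ?thesis
        using eventually_happens'[OF trivial_limit_at_right_real] by blast
    qed
    then obtain \<rho> where \<rho>: "\<And>i. d i < \<rho> i"
      "\<And>i. (2 * \<rho> i) powr t < (2 * d i) powr t + \<eta> * (1/2) ^ i"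
      by metis
    have \<rho>0: "0 < \<rho> i" for i using \<rho>(1)[of i] d(1)[of i] by simp
    define x where "x = (\<lambda>i. SOME p. p \<in> U i)"
    let ?box = "\<lambda>i. box (x i - \<rho> i *\<^sub>R One) (x i + \<rho> i *\<^sub>R One)"
    have Ubox: "U i \<subseteq> ?box i" for i
    proof
      fix p assume p: "p \<in> U i"
      then have "x i \<in> U i" unfolding x_def by (rule someI)
      then have "norm (p - x i) \<le> d i"
        using diameter_bounded_bound[OF U(2) p] by (simp add: d_def dist_norm)
      then have "\<bar>p \<bullet> b - x i \<bullet> b\<bar> < \<rho> i" if "b \<in> Basis" for b
        using Basis_le_norm[OF that, of "p - x i"] \<rho>(1)[of i] by (simp add: inner_diff_left)
      then show "p \<in> ?box i"
        unfolding mem_box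
        by (auto simp: inner_diff_left inner_add_left abs_less_iff algebra_simps)
    qed
    have cover: "C \<subseteq> (\<Union>i\<in>UNIV. ?box i)" using U(1) Ubox by blast
    obtain N where N: "finite N" "C \<subseteq> (\<Union>i\<in>N. ?box i)"
      by (rule compactE_image[OF C open_box cover])
    have powr_le: "ennreal (d i powr t) \<le> diam_powr s (U i)" for i
    proof -
      have "d i powr t \<le> d i powr s" if "s \<noteq> 0"
        using powr_mono'[of s t "d i"] st d by simp
      moreover have "d i powr t \<le> 1"
        using powr_le1[of t "d i"] t d by simp
      ultimately show ?thesis
        using t0 by (auto simp: diam_powr_def d_def)
    qed
    have "ennreal (\<Sum>i\<in>N. d i powr t) = (\<Sum>i\<in>N. ennreal (d i powr t))" by simp
    also have "\<dots> \<le> (\<Sum>i\<in>N. diam_powr s (U i))" by (intro sum_mono powr_le)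
    also have "\<dots> \<le> (\<Sum>i. diam_powr s (U i))" using N by (intro sum_le_suminf) auto
    also have "\<dots> < ennreal \<kappa>" by (rule sum)
    finally have small: "(\<Sum>i\<in>N. d i powr t) < \<kappa>"
      by (simp add: ennreal_less_iff sum_nonneg)
    have half: "(\<Sum>i\<in>N. (1/2::real) ^ i) \<le> 2"
      using sum_le_suminf[of "\<lambda>i. (1/2::real) ^ i" N] N
      by (simp add: summable_geometric suminf_geometric)
    have "l powr t \<le> (\<Sum>i\<in>N. (2 * \<rho> i) powr t)"
      using N \<rho>0 by (intro content) auto
    also have "\<dots> \<le> (\<Sum>i\<in>N. 2 powr t * d i powr t + \<eta> * (1/2) ^ i)"
      using less_imp_le[OF \<rho>(2)] d by (intro sum_mono) (simp add: powr_mult)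
    also have "\<dots> = 2 powr t * (\<Sum>i\<in>N. d i powr t) + \<eta> * (\<Sum>i\<in>N. (1/2) ^ i)"
      by (simp add: sum.distrib sum_distrib_left)
    also have "\<dots> < 2 powr t * \<kappa> + \<eta> * 2"
      using small half pos by (intro add_less_le_mono mult_strict_left_mono mult_left_mono) auto
    also have "\<dots> = l powr t" by (simp add: \<kappa>_def \<eta>_def)
    finally show False by simp
  qed
qed

section \<open>The dimension bound\<close>

theorem proposition20:
  fixes C0 C :: "'a::euclidean_space set"
    and G :: "nat \<Rightarrow> 'a set" and I :: "nat set"
  assumes "compact C0" and "convex C0" and "interior C0 \<noteq> {}"
    and "C = C0 - (\<Union>i\<in>I. G i)"
    and "bij_betw G I (gaps C)"
    and "\<And>i. i \<in> I \<Longrightarrow> G i \<subseteq> C0"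
    and "\<And>i. i \<in> I \<Longrightarrow> open (G i)"
    and "\<And>i. i \<in> I \<Longrightarrow> convex (G i)"
  shows "hausdorff_dim C \<ge>
    ereal (real DIM('a) - 1 +
      (if thickness C = 0 then 0
       else ln 2 / ln (2 + real_of_ereal (1 / thickness C))))"
proof -
  have im: "G ` I = gaps C" using assms(5) by (simp add: bij_betw_def)
  have C: "C = C0 - \<Union>(gaps C)" using assms(4) im by metis
  have \<G>: "open H \<and> convex H \<and> H \<subseteq> C0" if "H \<in> gaps C" for H
    using that assms(6-8) unfolding im[symmetric] by blast
  have "open (\<Union>(gaps C))" using \<G> by blast
  then have compC: "compact C" using assms(1) C compact_diff by metis
  have ext: "- C0 \<subseteq> exterior C"
    using assms(1,2) compC C
    by (intro Compl_convex_subset_exterior) (auto intro: compact_imp_bounded compact_imp_closed)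
  define q where "q = real_of_ereal (1 / thickness C)"
  define \<beta> where "\<beta> = (if thickness C = 0 then 0 else ln 2 / ln (2 + q))"
  have q0: "0 \<le> q"
    if "thickness C \<noteq> 0"
  proof (cases "gaps C = {}")
    case True
    then have "thickness C = \<infinity>" using that by (auto simp: thickness_def split: if_splits)
    then show ?thesis by (simp add: q_def)
  qed (use gap_separation(1)[OF compC that _ q_def] in simp)
  have \<beta>: "0 \<le> \<beta>" "\<beta> \<le> 1"
    using q0 by (auto simp: \<beta>_def)
  have \<beta>2: "(2 + q) powr \<beta> = 2" if "thickness C \<noteq> 0"
    using q0[OF that] that by (simp add: \<beta>_def powr_def)
  \<comment> \<open>a cube of side length \<open>l\<close> in \<open>C0\<close>\<close>
  obtain z \<epsilon> where z: "0 < \<epsilon>" "ball z \<epsilon> \<subseteq> C0"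
    using assms(3) by (meson ex_in_conv mem_interior)
  define l where "l = \<epsilon> / real DIM('a)"
  have l: "0 < l" using z by (simp add: l_def)
  have Q: "cbox (z - (l/2) *\<^sub>R One) (z + (l/2) *\<^sub>R One) \<subseteq> C0"
  proof
    fix y assume y: "y \<in> cbox (z - (l/2) *\<^sub>R One) (z + (l/2) *\<^sub>R One)"
    have "norm (y - z) \<le> (\<Sum>b\<in>Basis. \<bar>(y - z) \<bullet> b\<bar>)" by (rule norm_le_l1)
    also have "\<dots> \<le> (\<Sum>b\<in>(Basis :: 'a set). l/2)"
    proof (rule sum_mono)
      fix b :: 'a assume b: "b \<in> Basis"
      then have "z \<bullet> b - l/2 \<le> y \<bullet> b" "y \<bullet> b \<le> z \<bullet> b + l/2"
        using y by (auto simp: mem_box inner_diff_left inner_add_left)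
      then show "\<bar>(y - z) \<bullet> b\<bar> \<le> l/2" unfolding inner_diff_left by linarith
    qed
    also have "\<dots> < \<epsilon>" using z by (simp add: l_def)
    finally have "y \<in> ball z \<epsilon>" by (simp add: dist_norm norm_minus_commute)
    then show "y \<in> C0" using z by blast
  qed
  obtain e :: 'a where e: "e \<in> Basis" using nonempty_Basis by blast
  have "ereal (real DIM('a) - 1 + \<beta>) \<le> hausdorff_dim C"
  proof (rule hausdorff_dim_geI[OF compC _ l])
    show "0 \<le> real DIM('a) - 1 + \<beta>"
      using \<beta> DIM_positive[where 'a = 'a] by linarith
    fix N :: "nat set" and x :: "nat \<Rightarrow> 'a" and \<rho>
    assume N: "finite N" "\<And>i. i \<in> N \<Longrightarrow> 0 < \<rho> i"
      and cov: "C \<subseteq> (\<Union>i\<in>N. box (x i - \<rho> i *\<^sub>R One) (x i + \<rho> i *\<^sub>R One))"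
    show "l powr (real DIM('a) - 1 + \<beta>) \<le> (\<Sum>i\<in>N. (2 * \<rho> i) powr (real DIM('a) - 1 + \<beta>))"
    proof (rule sum_powr_ge_of_slices[OF e l N])
      fix y assume y: "y \<in> cbox (z - (l/2) *\<^sub>R One) (z + (l/2) *\<^sub>R One)"
      let ?M = "{i \<in> N. \<forall>b\<in>Basis - {e}. \<bar>(y - x i) \<bullet> b\<bar> < \<rho> i}"
      have yC0: "y \<in> C0" using y Q by blast
      show "l powr \<beta> \<le> (\<Sum>i\<in>?M. (2 * \<rho> i) powr \<beta>)"
      proof (cases "thickness C = 0")
        case True
        obtain i where i: "i \<in> ?M"
          using line_slice_nonempty[OF assms(1,2) C _ cov e yC0] \<G> by blast
        have "l powr \<beta> = (2 * \<rho> i) powr \<beta>"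
          using True l N(2)[of i] i by (simp add: \<beta>_def)
        also have "\<dots> \<le> (\<Sum>i\<in>?M. (2 * \<rho> i) powr \<beta>)"
          using N i by (intro member_le_sum) auto
        finally show ?thesis .
      next
        case False
        \<comment> \<open>the line enters the cube at parameter \<open>s\<close> and leaves it at \<open>s + l\<close>\<close>
        define s where "s = (z - y) \<bullet> e - l/2"
        have seg: "y + t *\<^sub>R e \<in> C0" if "t \<in> {s, s + l}" for t
        proof -
          have "y + t *\<^sub>R e \<in> cbox (z - (l/2) *\<^sub>R One) (z + (l/2) *\<^sub>R One)"
            unfolding mem_box
          proof
            fix b :: 'a assume b: "b \<in> Basis"
            then show "(z - (l/2) *\<^sub>R One) \<bullet> b \<le> (y + t *\<^sub>R e) \<bullet> b \<and>
                (y + t *\<^sub>R e) \<bullet> b \<le> (z + (l/2) *\<^sub>R One) \<bullet> b"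
              using y e that l
              by (cases "b = e")
                (auto simp: mem_box s_def inner_diff_left inner_add_left inner_Basis)
          qed
          then show ?thesis using Q by blast
        qed
        show ?thesis
        proof (rule line_slice_content[OF \<beta> \<beta>2 q0 assms(1,2) C \<G> _ _ N cov e _ _ _ yC0])
          fix H w v assume "H \<in> gaps C" "w \<in> closure H" "v \<in> closure (- C0)"
          then show "diameter H \<le> q * dist w v"
            using gap_separation(2)[OF compC False _ q_def] closure_mono[OF ext] by blast
        next
          fix H K w v assume "H \<in> gaps C" "K \<in> gaps C" "H \<noteq> K" "w \<in> closure H" "v \<in> closure K"
          then show "min (diameter H) (diameter K) \<le> q * dist w v"
            using gap_separation(3)[OF compC False _ q_def] by blast
        qed (use False l seg in auto)
      qed
    qed
  qed
  then show ?thesis unfolding \<beta>_def q_def .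
qed

end
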